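(* Four points $\alpha,\beta,\gamma,\delta$ in the plane are the orthographic projections of the vertices of a regular tetrahedron if and only if $$(\alpha+\beta+\gamma+\delta)^2=4(\alpha^2+\beta^2+\gamma^2+\delta^2),$$ where $\alpha,\beta,\gamma,\delta$ are regarded as complex numbers.
   Context: The orthographic projection is the standard projection $P:\mathbb{R}^3\to\mathbb{R}^2$ onto the first two coordinates, $P(x,y,w)=(x,y)$, and the plane $\mathbb{R}^2$ is identified with $\mathbb{C}$ via $(x,y)\mapsto x+iy$. The regular tetrahedron in $\mathbb{R}^3$ is not fixed in advance: it may be any tetrahedron obtained from a given regular one by a Euclidean motion together with an overall scaling. That $\alpha,\beta,\gamma,\delta$ are the projections of the vertices means that there is such a tetrahedron with vertices $p_1,p_2,p_3,p_4$ satisfying $P(p_1)=\alpha$, $P(p_2)=\beta$, $P(p_3)=\gamma$, $P(p_4)=\delta$.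
   Formalization: The four points are assumed not to all coincide: if α=β=γ=δ the equation always holds, but no regular tetrahedron of positive size projects to a single point, so the equivalence fails exactly there. *)

theory Defs
  imports "HOL-Analysis.Analysis"
begin

definition orthographic_projection :: "real ^ 3 \<Rightarrow> real ^ 2" where
  "orthographic_projection p = vector [p $ 1, p $ 2]"

definition plane_to_complex :: "real ^ 2 \<Rightarrow> complex" where
  "plane_to_complex v = Complex (v $ 1) (v $ 2)"

text \<open>
  A regular tetrahedron is given by its four labelled vertices. Equal positive edge lengths
  already force the vertices to be affinely independent, so the tetrahedron is non-degenerate.
\<close>

definition regular_tetrahedron :: "real ^ 3 \<Rightarrow> real ^ 3 \<Rightarrow> real ^ 3 \<Rightarrow> real ^ 3 \<Rightarrow> bool" where
  "regular_tetrahedron p1 p2 p3 p4 \<longleftrightarrow>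
     (\<exists>e>0. dist p1 p2 = e \<and> dist p1 p3 = e \<and> dist p1 p4 = e \<and>
            dist p2 p3 = e \<and> dist p2 p4 = e \<and> dist p3 p4 = e)"

definition euclidean_motion :: "(real ^ 3 \<Rightarrow> real ^ 3) \<Rightarrow> bool" where
  "euclidean_motion f \<longleftrightarrow> (\<forall>x y. dist (f x) (f y) = dist x y)"

text \<open>
  Scaling about the origin is enough below: a change of centre is a translation,
  which the motion absorbs.
\<close>

definition moved_and_scaled ::
  "real ^ 3 \<Rightarrow> real ^ 3 \<Rightarrow> real ^ 3 \<Rightarrow> real ^ 3 \<Rightarrow>
   real ^ 3 \<Rightarrow> real ^ 3 \<Rightarrow> real ^ 3 \<Rightarrow> real ^ 3 \<Rightarrow> bool" where
  "moved_and_scaled q1 q2 q3 q4 p1 p2 p3 p4 \<longleftrightarrow>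
     (\<exists>f c. euclidean_motion f \<and> c > 0 \<and>
        p1 = c *\<^sub>R f q1 \<and> p2 = c *\<^sub>R f q2 \<and> p3 = c *\<^sub>R f q3 \<and> p4 = c *\<^sub>R f q4)"

end

theory Submission imports Defs begin

text \<open>
  The vertices of a regular tetrahedron are alternate corners of a cube. With vertices
  \<open>p1, p2, p3, p4\<close>, the three vectors \<open>p1 + p2 - p3 - p4\<close>, \<open>p1 - p2 + p3 - p4\<close> and
  \<open>p1 - p2 - p3 + p4\<close> are twice the edge vectors of that cube, so the matrix having them as rows
  is a positive multiple of an orthogonal matrix
  (\<open>regular_tetrahedron_cube_matrix\<close>). An orthogonal matrix has orthonormal columns as well as
  orthonormal rows, and orthographic projection keeps precisely the first two columns. If
  \<open>x, y, z\<close> are the same three signed combinations of the projected points, then these columns are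
  the real and the imaginary parts of \<open>(x, y, z)\<close>. They have equal length and are perpendicular
  exactly when \<open>x\<^sup>2 + y\<^sup>2 + z\<^sup>2 = 0\<close> (\<open>sum_complex_squares_eq_0_iff\<close>), and by \<open>cube_sum_squares\<close>
  this is the asserted equation.

  Conversely, two perpendicular columns of equal length, which is positive because the four points
  do not all coincide, are completed by a multiple of
  their cross product to a multiple of an orthogonal matrix; its third column determines the
  heights of the four vertices up to a common translation (\<open>lift_to_cube_matrix\<close>). Two
  quadruples whose cube matrices are positive multiples of orthogonal matrices differ by a motion
  and a scaling (\<open>moved_and_scaled_if_cube_matrix\<close>), so the tetrahedron just constructed is a copy
  of the given one.
\<close>

section \<open>The circumscribed cube\<close>

definition cube_matrix :: "real ^ 3 \<Rightarrow> real ^ 3 \<Rightarrow> real ^ 3 \<Rightarrow> real ^ 3 \<Rightarrow> real ^ 3 ^ 3" where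
  "cube_matrix p1 p2 p3 p4 =
     vector [p1 + p2 - p3 - p4, p1 - p2 + p3 - p4, p1 - p2 - p3 + p4]"

lemma orthogonal_matrix_vector_3:
  fixes u v w :: "real ^ 3"
  assumes "norm u = 1" "norm v = 1" "norm w = 1" "u \<bullet> v = 0" "u \<bullet> w = 0" "v \<bullet> w = 0"
  shows "orthogonal_matrix (vector [u, v, w] :: real ^ 3 ^ 3)"
  using assms
  by (simp add: orthogonal_matrix_orthonormal_rows forall_3 row_def
      orthogonal_def inner_commute)

text \<open>
  Opposite edges of a regular tetrahedron are perpendicular, and each row is a sum of two opposite
  edge vectors; this is where the factor \<open>sqrt 2\<close> comes from.
\<close>

lemma regular_tetrahedron_cube_matrix:
  assumes "regular_tetrahedron p1 p2 p3 p4"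
  obtains s Q where "s > 0" "orthogonal_matrix Q" "cube_matrix p1 p2 p3 p4 = s *\<^sub>R Q"
proof -
  obtain e where e: "e > 0" "dist p1 p2 = e" "dist p1 p3 = e" "dist p1 p4 = e"
      "dist p2 p3 = e" "dist p2 p4 = e" "dist p3 p4 = e"
    using assms unfolding regular_tetrahedron_def by (elim exE conjE) (rule that)
  define a b c where "a = p2 - p1" and "b = p3 - p1" and "c = p4 - p1"
  have sq: "x \<bullet> x = e\<^sup>2" if "norm x = e" for x :: "real ^ 3"
    using that by (simp add: power2_norm_eq_inner[symmetric])
  have aa: "a \<bullet> a = e\<^sup>2" "b \<bullet> b = e\<^sup>2" "c \<bullet> c = e\<^sup>2"
    by (rule sq, use e in \<open>simp add: a_def b_def c_def dist_norm[symmetric] dist_commute\<close>)+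
  have dd: "(b - a) \<bullet> (b - a) = e\<^sup>2" "(c - a) \<bullet> (c - a) = e\<^sup>2" "(c - b) \<bullet> (c - b) = e\<^sup>2"
    by (rule sq, use e in \<open>simp add: a_def b_def c_def dist_norm[symmetric] dist_commute\<close>)+
  have ab: "a \<bullet> b = e\<^sup>2 / 2" "a \<bullet> c = e\<^sup>2 / 2" "b \<bullet> c = e\<^sup>2 / 2"
    using aa dd by (simp_all add: inner_diff_left inner_diff_right inner_commute)
  define s where "s = sqrt 2 * e"
  have s: "s > 0" "s\<^sup>2 = 2 * e\<^sup>2"
    using e(1) by (simp_all add: s_def power_mult_distrib)
  define X Y Z where "X = a - b - c" and "Y = b - a - c" and "Z = c - a - b"
  have rows: "cube_matrix p1 p2 p3 p4 = vector [X, Y, Z]"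
    by (simp add: cube_matrix_def X_def Y_def Z_def a_def b_def c_def algebra_simps)
  note exp = X_def Y_def Z_def inner_diff_left inner_diff_right inner_commute
  have "X \<bullet> X = s\<^sup>2" "Y \<bullet> Y = s\<^sup>2" "Z \<bullet> Z = s\<^sup>2"
    using aa ab by (simp_all add: s(2) exp)
  then have n: "norm X = s" "norm Y = s" "norm Z = s"
    using s(1) by (simp_all add: norm_eq_sqrt_inner)
  have o: "X \<bullet> Y = 0" "X \<bullet> Z = 0" "Y \<bullet> Z = 0"
    using aa ab by (simp_all add: exp)
  have "orthogonal_matrix (vector [X /\<^sub>R s, Y /\<^sub>R s, Z /\<^sub>R s] :: real ^ 3 ^ 3)"
    using n o s(1) by (intro orthogonal_matrix_vector_3) simp_all
  moreover have "cube_matrix p1 p2 p3 p4 = s *\<^sub>R vector [X /\<^sub>R s, Y /\<^sub>R s, Z /\<^sub>R s]"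
    using s(1) by (simp add: rows vec_eq_iff forall_3)
  ultimately show thesis
    using s(1) that by blast
qed

text \<open>
  The coefficient vectors are independent of the points, so an equation between
  cube matrices carries over to the edge vectors.
\<close>

lemma edge_eq_transpose_cube_matrix:
  "p2 - p1 = transpose (cube_matrix p1 p2 p3 p4) *v vector [0, - 1/2, - 1/2]"
  "p3 - p1 = transpose (cube_matrix p1 p2 p3 p4) *v vector [- 1/2, 0, - 1/2]"
  "p4 - p1 = transpose (cube_matrix p1 p2 p3 p4) *v vector [- 1/2, - 1/2, 0]"
  by (simp_all add: vec_eq_iff cube_matrix_def transpose_def matrix_vector_mult_def sum_3
      field_simps)

section \<open>Motions and scalings\<close>

lemma moved_and_scaled_regular_tetrahedron:
  assumes "regular_tetrahedron q1 q2 q3 q4" "moved_and_scaled q1 q2 q3 q4 p1 p2 p3 p4"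
  shows "regular_tetrahedron p1 p2 p3 p4"
proof -
  obtain e where e: "e > 0" "dist q1 q2 = e" "dist q1 q3 = e" "dist q1 q4 = e"
      "dist q2 q3 = e" "dist q2 q4 = e" "dist q3 q4 = e"
    using assms(1) unfolding regular_tetrahedron_def by (elim exE conjE) (rule that)
  obtain f c where f: "\<And>x y. dist (f x) (f y) = dist x y" and "c > 0"
    and p: "p1 = c *\<^sub>R f q1" "p2 = c *\<^sub>R f q2" "p3 = c *\<^sub>R f q3" "p4 = c *\<^sub>R f q4"
    using assms(2) by (auto simp: moved_and_scaled_def euclidean_motion_def)
  have d: "dist (c *\<^sub>R f x) (c *\<^sub>R f y) = c * dist x y" for x y
    using \<open>c > 0\<close> f[of x y] by (simp add: dist_norm flip: scaleR_diff_right)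
  show ?thesis
    unfolding regular_tetrahedron_def p
    by (rule exI[of _ "c * e"]) (use e \<open>c > 0\<close> in \<open>simp add: d\<close>)
qed

text \<open>
  The motion has linear part \<open>transpose R ** Q\<close>, which carries the edge directions of
  one cube to those of the other.
\<close>

lemma moved_and_scaled_if_cube_matrix:
  assumes "s > 0" "orthogonal_matrix Q" "cube_matrix q1 q2 q3 q4 = s *\<^sub>R Q"
    and "t > 0" "orthogonal_matrix R" "cube_matrix p1 p2 p3 p4 = t *\<^sub>R R"
  shows "moved_and_scaled q1 q2 q3 q4 p1 p2 p3 p4"
proof -
  define A where "A = transpose R ** Q"
  define c where "c = t / s"
  define f where "f v = p1 /\<^sub>R c + A *v (v - q1)" for v
  have "c > 0"
    using assms by (simp add: c_def)
  have "orthogonal_matrix A"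
    using assms by (simp add: A_def orthogonal_matrix_mul orthogonal_matrix_transpose)
  then have "norm (A *v x) = norm x" for x
    using orthogonal_transformation_norm[of "(*v) A"]
    by (simp add: orthogonal_transformation_matrix)
  then have motion: "euclidean_motion f"
    by (simp add: euclidean_motion_def f_def dist_norm
        matrix_vector_mult_diff_distrib[symmetric])
  have "A ** transpose Q = transpose R"
    using assms(2) by (simp add: A_def orthogonal_matrix_def flip: matrix_mul_assoc)
  then have rotate: "A *v (transpose Q *v w) = transpose R *v w" for w
    by (simp only: matrix_vector_mul_assoc)
  have scale: "transpose (r *\<^sub>R M) *v w = r *\<^sub>R (transpose M *v w)"
    for r w and M :: "real ^ 3 ^ 3"
    by (simp only: transpose_scalar scaleR_matrix_vector_assoc)
  have edge: "c *\<^sub>R (A *v (transpose (cube_matrix q1 q2 q3 q4) *v w)) =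
      transpose (cube_matrix p1 p2 p3 p4) *v w" for w
    unfolding assms(3,6) scale matrix_vector_mult_scaleR rotate
    using assms(1) by (simp add: c_def)
  have image: "c *\<^sub>R f q = p" if "q - q1 = transpose (cube_matrix q1 q2 q3 q4) *v w"
    "p - p1 = transpose (cube_matrix p1 p2 p3 p4) *v w" for p q w
  proof -
    have "c *\<^sub>R f q = p1 + c *\<^sub>R (A *v (q - q1))"
      using \<open>c > 0\<close> by (simp add: f_def scaleR_right_distrib)
    also have "\<dots> = p"
      using edge[of w] that by (metis add.commute diff_add_cancel)
    finally show ?thesis .
  qed
  have "c *\<^sub>R f q1 = p1"
    using \<open>c > 0\<close> by (simp add: f_def)
  moreover have "c *\<^sub>R f q2 = p2" "c *\<^sub>R f q3 = p3" "c *\<^sub>R f q4 = p4"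
    by (rule image; rule edge_eq_transpose_cube_matrix)+
  ultimately have "p1 = c *\<^sub>R f q1" "p2 = c *\<^sub>R f q2" "p3 = c *\<^sub>R f q3" "p4 = c *\<^sub>R f q4"
    by simp_all
  then show ?thesis
    using motion \<open>c > 0\<close> unfolding moved_and_scaled_def by blast
qed

section \<open>The complex equation\<close>

lemma cube_sum_squares:
  fixes \<alpha> \<beta> \<gamma> \<delta> :: "'a :: comm_ring_1"
  shows "(\<alpha> + \<beta> - \<gamma> - \<delta>)\<^sup>2 + (\<alpha> - \<beta> + \<gamma> - \<delta>)\<^sup>2 + (\<alpha> - \<beta> - \<gamma> + \<delta>)\<^sup>2 =
    4 * (\<alpha>\<^sup>2 + \<beta>\<^sup>2 + \<gamma>\<^sup>2 + \<delta>\<^sup>2) - (\<alpha> + \<beta> + \<gamma> + \<delta>)\<^sup>2"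
  by (simp add: power2_eq_square algebra_simps)

text \<open>
  The real part of a sum of complex squares compares the lengths of the vectors of real and imaginary
  parts, and the imaginary part is twice their inner product.
\<close>

lemma sum_complex_squares_eq_0_iff:
  fixes x y z :: complex
  defines "a \<equiv> (vector [Re x, Re y, Re z] :: real ^ 3)"
    and "b \<equiv> (vector [Im x, Im y, Im z] :: real ^ 3)"
  shows "x\<^sup>2 + y\<^sup>2 + z\<^sup>2 = 0 \<longleftrightarrow> norm a = norm b \<and> a \<bullet> b = 0"
proof -
  have "Re (x\<^sup>2 + y\<^sup>2 + z\<^sup>2) = a \<bullet> a - b \<bullet> b" "Im (x\<^sup>2 + y\<^sup>2 + z\<^sup>2) = 2 * (a \<bullet> b)"
    by (simp_all add: a_def b_def inner_vec_def sum_3 power2_eq_square)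
  then show ?thesis
    by (simp add: complex_eq_iff norm_eq)
qed

lemma column_scaled_orthogonal_matrix:
  fixes Q :: "real ^ 'n ^ 'n"
  assumes "orthogonal_matrix Q"
  shows "column i (s *\<^sub>R Q) \<bullet> column j (s *\<^sub>R Q) = (if i = j then s\<^sup>2 else 0)"
proof -
  have "column k (s *\<^sub>R Q) = s *\<^sub>R column k Q" for k
    by (simp add: vec_eq_iff column_def)
  moreover have "column i Q \<bullet> column j Q = (if i = j then 1 else 0)"
    using assms(1) unfolding orthogonal_matrix_orthonormal_columns orthogonal_def norm_eq_1 by auto
  ultimately show ?thesis
    by (simp add: power2_eq_square)
qed

lemma orthogonal_matrix_columns_cross3:
  fixes u v :: "real ^ 3"
  assumes "norm u = 1" "norm v = 1" "u \<bullet> v = 0"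
  shows "orthogonal_matrix (transpose (vector [u, v, cross3 u v]))"
proof -
  have "(norm (cross3 u v))\<^sup>2 = 1"
    using norm_cross[of u v] assms by simp
  then have "norm (cross3 u v) = 1"
    by (simp add: power2_eq_1_iff) (use norm_ge_zero[of "cross3 u v"] in linarith)
  then show ?thesis
    using assms
    by (simp add: orthogonal_matrix_transpose orthogonal_matrix_vector_3 dot_cross_self)
qed

text \<open>
  The heights are obtained from the third column \<open>k\<close> by inverting the sign pattern of the cube
  matrix, with the sum of the heights normalised to be zero.
\<close>

lemma lift_to_cube_matrix:
  fixes \<alpha> \<beta> \<gamma> \<delta> :: complex
  defines "x \<equiv> \<alpha> + \<beta> - \<gamma> - \<delta>" and "y \<equiv> \<alpha> - \<beta> + \<gamma> - \<delta>" and "z \<equiv> \<alpha> - \<beta> - \<gamma> + \<delta>"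
  assumes "x\<^sup>2 + y\<^sup>2 + z\<^sup>2 = 0" and "\<not> (x = 0 \<and> y = 0 \<and> z = 0)"
  obtains s Q p1 p2 p3 p4 where "s > 0" "orthogonal_matrix Q" "cube_matrix p1 p2 p3 p4 = s *\<^sub>R Q"
    "plane_to_complex (orthographic_projection p1) = \<alpha>"
    "plane_to_complex (orthographic_projection p2) = \<beta>"
    "plane_to_complex (orthographic_projection p3) = \<gamma>"
    "plane_to_complex (orthographic_projection p4) = \<delta>"
proof -
  define a where "a = (vector [Re x, Re y, Re z] :: real ^ 3)"
  define b where "b = (vector [Im x, Im y, Im z] :: real ^ 3)"
  define s where "s = norm a"
  have ab: "norm a = s" "norm b = s" "a \<bullet> b = 0"
    using assms(4) by (simp_all add: sum_complex_squares_eq_0_iff a_def b_def s_def)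
  have "\<not> (a = 0 \<and> b = 0)"
    using assms(5) by (auto simp: a_def b_def vec_eq_iff forall_3 complex_eq_iff)
  then have "s > 0"
    using ab by auto
  define u v k where "u = a /\<^sub>R s" and "v = b /\<^sub>R s" and "k = s *\<^sub>R cross3 u v"
  define Q where "Q = (transpose (vector [u, v, cross3 u v]) :: real ^ 3 ^ 3)"
  have "orthogonal_matrix Q"
    unfolding Q_def using ab \<open>s > 0\<close>
    by (intro orthogonal_matrix_columns_cross3) (simp_all add: u_def v_def)
  define p1 where "p1 = (vector [Re \<alpha>, Im \<alpha>, (k $ 1 + k $ 2 + k $ 3) / 4] :: real ^ 3)"
  define p2 where "p2 = (vector [Re \<beta>, Im \<beta>, (k $ 1 - k $ 2 - k $ 3) / 4] :: real ^ 3)"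
  define p3 where "p3 = (vector [Re \<gamma>, Im \<gamma>, (- k $ 1 + k $ 2 - k $ 3) / 4] :: real ^ 3)"
  define p4 where "p4 = (vector [Re \<delta>, Im \<delta>, (- k $ 1 - k $ 2 + k $ 3) / 4] :: real ^ 3)"
  have "s *\<^sub>R Q = transpose (vector [a, b, k])"
    using \<open>s > 0\<close>
    by (simp add: vec_eq_iff forall_3 Q_def transpose_def u_def v_def k_def)
  also have "\<dots> = cube_matrix p1 p2 p3 p4"
    by (simp add: vec_eq_iff forall_3 cube_matrix_def transpose_def a_def b_def
        p1_def p2_def p3_def p4_def x_def y_def z_def field_simps)
  finally have cube: "cube_matrix p1 p2 p3 p4 = s *\<^sub>R Q" by simp
  show thesis
    by (rule that[OF \<open>s > 0\<close> \<open>orthogonal_matrix Q\<close> cube])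
      (simp_all add: plane_to_complex_def orthographic_projection_def p1_def p2_def p3_def p4_def)
qed

section \<open>The characterisation\<close>


theorem mainTheorem1:
  fixes \<alpha> \<beta> \<gamma> \<delta> :: complex
    and q1 q2 q3 q4 :: "real ^ 3"
  assumes "regular_tetrahedron q1 q2 q3 q4"
    and "\<not> (\<alpha> = \<beta> \<and> \<beta> = \<gamma> \<and> \<gamma> = \<delta>)"
  shows "(\<exists>p1 p2 p3 p4. moved_and_scaled q1 q2 q3 q4 p1 p2 p3 p4 \<and>
            plane_to_complex (orthographic_projection p1) = \<alpha> \<and>
            plane_to_complex (orthographic_projection p2) = \<beta> \<and>
            plane_to_complex (orthographic_projection p3) = \<gamma> \<and>
            plane_to_complex (orthographic_projection p4) = \<delta>)
     \<longleftrightarrow> (\<alpha> + \<beta> + \<gamma> + \<delta>)\<^sup>2 = 4 * (\<alpha>\<^sup>2 + \<beta>\<^sup>2 + \<gamma>\<^sup>2 + \<delta>\<^sup>2)"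
proof -
  define x y z where "x = \<alpha> + \<beta> - \<gamma> - \<delta>" and "y = \<alpha> - \<beta> + \<gamma> - \<delta>" and "z = \<alpha> - \<beta> - \<gamma> + \<delta>"
  have equation: "(\<alpha> + \<beta> + \<gamma> + \<delta>)\<^sup>2 = 4 * (\<alpha>\<^sup>2 + \<beta>\<^sup>2 + \<gamma>\<^sup>2 + \<delta>\<^sup>2) \<longleftrightarrow> x\<^sup>2 + y\<^sup>2 + z\<^sup>2 = 0"
    unfolding x_def y_def z_def cube_sum_squares by auto
  show ?thesis
    unfolding equation
  proof
    assume "\<exists>p1 p2 p3 p4. moved_and_scaled q1 q2 q3 q4 p1 p2 p3 p4 \<and>
            plane_to_complex (orthographic_projection p1) = \<alpha> \<and>
            plane_to_complex (orthographic_projection p2) = \<beta> \<and>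
            plane_to_complex (orthographic_projection p3) = \<gamma> \<and>
            plane_to_complex (orthographic_projection p4) = \<delta>"
    then obtain p1 p2 p3 p4 where p: "moved_and_scaled q1 q2 q3 q4 p1 p2 p3 p4"
      and proj: "\<alpha> = Complex (p1 $ 1) (p1 $ 2)" "\<beta> = Complex (p2 $ 1) (p2 $ 2)"
        "\<gamma> = Complex (p3 $ 1) (p3 $ 2)" "\<delta> = Complex (p4 $ 1) (p4 $ 2)"
      by (auto simp: plane_to_complex_def orthographic_projection_def)
    obtain s Q where Q: "s > 0" "orthogonal_matrix Q" "cube_matrix p1 p2 p3 p4 = s *\<^sub>R Q"
      using regular_tetrahedron_cube_matrix moved_and_scaled_regular_tetrahedron[OF assms(1) p]
      by blast
    have cols: "vector [Re x, Re y, Re z] = column 1 (cube_matrix p1 p2 p3 p4)"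
      "vector [Im x, Im y, Im z] = column 2 (cube_matrix p1 p2 p3 p4)"
      by (simp_all add: vec_eq_iff forall_3 column_def cube_matrix_def proj x_def y_def z_def)
    show "x\<^sup>2 + y\<^sup>2 + z\<^sup>2 = 0"
      unfolding sum_complex_squares_eq_0_iff cols Q(3) norm_eq
      using Q by (simp add: column_scaled_orthogonal_matrix)
  next
    assume sum: "x\<^sup>2 + y\<^sup>2 + z\<^sup>2 = 0"
    have "\<not> (x = 0 \<and> y = 0 \<and> z = 0)"
    proof
      assume "x = 0 \<and> y = 0 \<and> z = 0"
      then have "x + y = 0" "x + z = 0" "y + z = 0" by simp_all
      then have "\<alpha> = \<delta>" "\<alpha> = \<gamma>" "\<alpha> = \<beta>"
        by (simp_all add: x_def y_def z_def)
      then show False using assms(2) by simp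
    qed
    then obtain t R p1 p2 p3 p4
      where R: "t > 0" "orthogonal_matrix R" "cube_matrix p1 p2 p3 p4 = t *\<^sub>R R"
      and proj: "plane_to_complex (orthographic_projection p1) = \<alpha>"
        "plane_to_complex (orthographic_projection p2) = \<beta>"
        "plane_to_complex (orthographic_projection p3) = \<gamma>"
        "plane_to_complex (orthographic_projection p4) = \<delta>"
      using sum unfolding x_def y_def z_def by (metis lift_to_cube_matrix)
    obtain s Q where "s > 0" "orthogonal_matrix Q" "cube_matrix q1 q2 q3 q4 = s *\<^sub>R Q"
      using regular_tetrahedron_cube_matrix assms(1) by blast
    then have "moved_and_scaled q1 q2 q3 q4 p1 p2 p3 p4"
      using R by (rule moved_and_scaled_if_cube_matrix)
    then show "\<exists>p1 p2 p3 p4. moved_and_scaled q1 q2 q3 q4 p1 p2 p3 p4 \<and>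
            plane_to_complex (orthographic_projection p1) = \<alpha> \<and>
            plane_to_complex (orthographic_projection p2) = \<beta> \<and>
            plane_to_complex (orthographic_projection p3) = \<gamma> \<and>
            plane_to_complex (orthographic_projection p4) = \<delta>"
      using proj by blast
  qed
qed

end
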